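(* Let $X$ be a locally convex Hausdorff real topological vector space, let $(f_i)_{i\in I}$ be a family of proper functions $f_i:X\to\mathbb R\cup\{+\infty\}$ with robust sum $f$, and let $\overline{x}^*\in X^*$. Let $x\in\operatorname{dom} f$ and $(J,(x_j^* )_{j\in J})\in\mathbb F(\overline{x}^* )$. The following statements are equivalent: (i) $x\in\operatorname{sol}(\mathrm{RP}_{\overline{x}^*})$, $(J,(x_j^* )_{j\in J})\in\operatorname{sol}(\mathrm{RD}_{\overline{x}^*})$, and $\inf(\mathrm{RP}_{\overline{x}^*})=\sup(\mathrm{RD}_{\overline{x}^*})$. (ii) $J\in S_f(x)$ and $x_j^*\in\partial f_j(x)$ for all $j\in J$. (iii) $x\in T_f(J)\cap\Big(\bigcap_{j\in J}M_{f_j}(x_j^* )\Big)$. If moreover $(f_i)_{i\in I}\subset\Gamma(X)$, then these are also equivalent to: (iv) $x\in T_f(J)\cap\Big(\bigcap_{j\in J}\partial f_j^*(x_j^* )\Big)$.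
   Context: $X^*$ is the topological dual of $X$ and $\langle x^*,x\rangle$ the duality pairing. $I$ is an infinite index set and $\mathcal F(I)$ is the collection of all nonempty finite subsets of $I$. The robust sum is $f(x)=\sum_{i\in I}^R f_i(x):=\sup_{J\in\mathcal F(I)}\sum_{i\in J}f_i(x)$. For $h:X\to\overline{\mathbb R}$, $\operatorname{dom}h=\{x:h(x)<+\infty\}$, $h^*(x^* )=\sup_{x\in X}\{\langle x^*,x\rangle-h(x)\}$, and $\partial h(a)=\{x^*\in X^*: h(x)\ge h(a)+\langle x^*,x-a\rangle\ \forall x\in X\}$ if $h(a)\in\mathbb R$, $\partial h(a)=\emptyset$ otherwise. Similarly, for $h:X^*\to\overline{\mathbb R}$, $\partial h(a^* )=\{x\in X: h(x^* )\ge h(a^* )+\langle x^*-a^*,x\rangle\ \forall x^*\in X^*\}$ if $h(a^* )\in\mathbb R$, and $\emptyset$ otherwise. $\Gamma(X)$ is the set of proper lower semicontinuous convex functions on $X$. Feasible dual set: $\mathbb F(\overline{x}^* )=\{(J,(x_j^* )_{j\in J}): J\in\mathcal F(I),\ (x_j^* )_{j\in J}\in(X^* )^J,\ \sum_{j\in J}x_j^*=\overline{x}^*\}$. Primal problem $(\mathrm{RP}_{\overline{x}^*})$: $\inf\{f(x)-\langle\overline{x}^*,x\rangle:x\in X\}$. Dual problem $(\mathrm{RD}_{\overline{x}^*})$: $\sup\{-\sum_{j\in J}f_j^*(x_j^* ):(J,(x_j^* )_{j\in J})\in\mathbb F(\overline{x}^* )\}$. $\operatorname{sol}(\mathrm{RP}_{\overline{x}^*})=\{x\in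 X: f(x)-\langle\overline{x}^*,x\rangle=\inf(\mathrm{RP}_{\overline{x}^*})\}$ and $\operatorname{sol}(\mathrm{RD}_{\overline{x}^*})=\{(J,(x_j^* )_{j\in J})\in\mathbb F(\overline{x}^* ): -\sum_{j\in J}f_j^*(x_j^* )=\sup(\mathrm{RD}_{\overline{x}^*})\}$. For $x\in X$: $S_f(x)=\{J\in\mathcal F(I):\sum_{j\in J}f_j(x)=f(x)\}$ if $x\in\operatorname{dom}f$, and $S_f(x)=\emptyset$ otherwise. $T_f:\mathcal F(I)\rightrightarrows X$ is the inverse of $S_f$: $x\in T_f(J)\iff J\in S_f(x)$. For $g:X\to\overline{\mathbb R}$, $M_g:X^*\rightrightarrows X$ is given by $M_g(x^* )=\operatorname{argmin}(g-\langle x^*,\cdot\rangle)$ if $g^*(x^* )\in\mathbb R$ and $M_g(x^* )=\emptyset$ otherwise; equivalently, $x\in M_g(x^* )\iff x^*\in\partial g(x)$. *)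

theory Defs
  imports "HOL-Analysis.Analysis"
begin

text \<open>
  The constant \<open>convex\<close> is not available inside a class specification, so
  \<open>locally_convex_raw\<close> contains its unfolded definition; see
  \<open>locally_convex_zero\<close> below.
\<close>

class locally_convex_space = real_vector + topological_ab_group_add + t2_space +
  assumes tendsto_scaleR_Pair:
      "LIM p (nhds r \<times>\<^sub>F nhds x). fst p *\<^sub>R snd p :> nhds (r *\<^sub>R x)"
    and locally_convex_raw:
      "open U \<Longrightarrow> 0 \<in> U \<Longrightarrow>
         \<exists>V. open V \<and>
             (\<forall>x\<in>V. \<forall>y\<in>V. \<forall>u\<ge>0. \<forall>v\<ge>0. u + v = 1 \<longrightarrow> u *\<^sub>R x + v *\<^sub>R y \<in> V) \<and>
             0 \<in> V \<and> V \<subseteq> U"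

lemma locally_convex_zero:
  fixes U :: "'a::locally_convex_space set"
  assumes "open U" "0 \<in> U"
  shows "\<exists>V. open V \<and> convex V \<and> 0 \<in> V \<and> V \<subseteq> U"
  using locally_convex_raw[OF assms] unfolding convex_def by blast

instance real_normed_vector < locally_convex_space
proof
  fix r :: real and x :: 'a
  show "LIM p (nhds r \<times>\<^sub>F nhds x). fst p *\<^sub>R snd p :> nhds (r *\<^sub>R x)"
    by (intro tendsto_scaleR filterlim_fst filterlim_snd)
next
  fix U :: "'a set"
  assume "open U" "0 \<in> U"
  then obtain e where "e > 0" "ball 0 e \<subseteq> U"
    by (auto simp: open_contains_ball)
  then have "open (ball (0::'a) e) \<and> convex (ball (0::'a) e) \<and> 0 \<in> ball (0::'a) e \<and> ball 0 e \<subseteq> U"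
    by auto
  then show "\<exists>V. open V \<and>
      (\<forall>x\<in>V. \<forall>y\<in>V. \<forall>u\<ge>0. \<forall>v\<ge>0. u + v = 1 \<longrightarrow> u *\<^sub>R x + v *\<^sub>R y \<in> V) \<and>
      0 \<in> V \<and> V \<subseteq> U"
    unfolding convex_def by blast
qed

text \<open>
  The topological dual is a set of plain functions; functions on the dual are
  represented by functions on all of \<open>'a \<Rightarrow> real\<close>, of which only the values on
  \<open>top_dual\<close> matter. No topology on the dual is involved.
\<close>

definition top_dual :: "('a::locally_convex_space \<Rightarrow> real) set" where
  "top_dual = {\<phi>. linear \<phi> \<and> continuous_on UNIV \<phi>}"

definition edom :: "('a \<Rightarrow> ereal) \<Rightarrow> 'a set" where
  "edom h = {x. h x < \<infinity>}"

definition proper_fun :: "('a \<Rightarrow> ereal) \<Rightarrow> bool" where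
  "proper_fun h \<longleftrightarrow> (\<forall>x. h x \<noteq> - \<infinity>) \<and> edom h \<noteq> {}"

definition lsc_fun :: "('a::topological_space \<Rightarrow> ereal) \<Rightarrow> bool" where
  "lsc_fun h \<longleftrightarrow> (\<forall>x. \<forall>c < h x. \<forall>\<^sub>F y in nhds x. c < h y)"

text \<open>Convexity of the epigraph, since \<open>convex_on\<close> only covers real-valued functions.\<close>

definition convex_fun :: "('a::real_vector \<Rightarrow> ereal) \<Rightarrow> bool" where
  "convex_fun h \<longleftrightarrow> convex {(x, r :: real). h x \<le> ereal r}"

definition Gamma_fun :: "('a::locally_convex_space \<Rightarrow> ereal) set" where
  "Gamma_fun = {h. proper_fun h \<and> lsc_fun h \<and> convex_fun h}"

definition fconj :: "('a \<Rightarrow> ereal) \<Rightarrow> ('a \<Rightarrow> real) \<Rightarrow> ereal" where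
  "fconj h \<phi> = (SUP x. ereal (\<phi> x) - h x)"

definition subdiff ::
    "('a::locally_convex_space \<Rightarrow> ereal) \<Rightarrow> 'a \<Rightarrow> ('a \<Rightarrow> real) set" where
  "subdiff h a =
     (if \<bar>h a\<bar> \<noteq> \<infinity> then {\<phi> \<in> top_dual. \<forall>x. h x \<ge> h a + ereal (\<phi> (x - a))} else {})"

definition subdiff_dual ::
    "(('a::locally_convex_space \<Rightarrow> real) \<Rightarrow> ereal) \<Rightarrow> ('a \<Rightarrow> real) \<Rightarrow> 'a set" where
  "subdiff_dual h \<alpha> =
     (if \<bar>h \<alpha>\<bar> \<noteq> \<infinity> then {x. \<forall>\<phi> \<in> top_dual. h \<phi> \<ge> h \<alpha> + ereal (\<phi> x - \<alpha> x)} else {})"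

definition argmin_set :: "('a \<Rightarrow> ereal) \<Rightarrow> 'a set" where
  "argmin_set h = {x. h x = (INF y. h y)}"

definition M_map :: "('a \<Rightarrow> ereal) \<Rightarrow> ('a \<Rightarrow> real) \<Rightarrow> 'a set" where
  "M_map g \<phi> = (if \<bar>fconj g \<phi>\<bar> \<noteq> \<infinity> then argmin_set (\<lambda>x. g x - ereal (\<phi> x)) else {})"

definition fin_subsets :: "'i set \<Rightarrow> 'i set set" where
  "fin_subsets I = {J. J \<subseteq> I \<and> finite J \<and> J \<noteq> {}}"

definition robust_sum :: "'i set \<Rightarrow> ('i \<Rightarrow> 'a \<Rightarrow> ereal) \<Rightarrow> 'a \<Rightarrow> ereal" where
  "robust_sum I f x = (SUP J \<in> fin_subsets I. \<Sum>i\<in>J. f i x)"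

definition S_map :: "'i set \<Rightarrow> ('i \<Rightarrow> 'a \<Rightarrow> ereal) \<Rightarrow> 'a \<Rightarrow> 'i set set" where
  "S_map I f x =
     (if x \<in> edom (robust_sum I f)
      then {J \<in> fin_subsets I. (\<Sum>j\<in>J. f j x) = robust_sum I f x} else {})"

definition T_map :: "'i set \<Rightarrow> ('i \<Rightarrow> 'a \<Rightarrow> ereal) \<Rightarrow> 'i set \<Rightarrow> 'a set" where
  "T_map I f J = {x. J \<in> S_map I f x}"

definition dual_feasible ::
    "'i set \<Rightarrow> ('a::locally_convex_space \<Rightarrow> real) \<Rightarrow> ('i set \<times> ('i \<Rightarrow> 'a \<Rightarrow> real)) set" where
  "dual_feasible I \<phi> =
     {(J, \<xi>). J \<in> fin_subsets I \<and> \<xi> \<in> J \<rightarrow>\<^sub>E top_dual \<and> (\<forall>x. (\<Sum>j\<in>J. \<xi> j x) = \<phi> x)}"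

definition RP_obj :: "'i set \<Rightarrow> ('i \<Rightarrow> 'a \<Rightarrow> ereal) \<Rightarrow> ('a \<Rightarrow> real) \<Rightarrow> 'a \<Rightarrow> ereal" where
  "RP_obj I f \<phi> x = robust_sum I f x - ereal (\<phi> x)"

definition inf_RP :: "'i set \<Rightarrow> ('i \<Rightarrow> 'a \<Rightarrow> ereal) \<Rightarrow> ('a \<Rightarrow> real) \<Rightarrow> ereal" where
  "inf_RP I f \<phi> = (INF x. RP_obj I f \<phi> x)"

definition sol_RP :: "'i set \<Rightarrow> ('i \<Rightarrow> 'a \<Rightarrow> ereal) \<Rightarrow> ('a \<Rightarrow> real) \<Rightarrow> 'a set" where
  "sol_RP I f \<phi> = {x. RP_obj I f \<phi> x = inf_RP I f \<phi>}"

definition RD_obj :: "('i \<Rightarrow> 'a \<Rightarrow> ereal) \<Rightarrow> 'i set \<times> ('i \<Rightarrow> 'a \<Rightarrow> real) \<Rightarrow> ereal" where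
  "RD_obj f = (\<lambda>(J, \<xi>). - (\<Sum>j\<in>J. fconj (f j) (\<xi> j)))"

definition sup_RD ::
    "'i set \<Rightarrow> ('i \<Rightarrow> 'a::locally_convex_space \<Rightarrow> ereal) \<Rightarrow> ('a \<Rightarrow> real) \<Rightarrow> ereal" where
  "sup_RD I f \<phi> = (SUP p \<in> dual_feasible I \<phi>. RD_obj f p)"

definition sol_RD ::
    "'i set \<Rightarrow> ('i \<Rightarrow> 'a::locally_convex_space \<Rightarrow> ereal) \<Rightarrow> ('a \<Rightarrow> real) \<Rightarrow>
     ('i set \<times> ('i \<Rightarrow> 'a \<Rightarrow> real)) set" where
  "sol_RD I f \<phi> = {p \<in> dual_feasible I \<phi>. RD_obj f p = sup_RD I f \<phi>}"

end

theory Submission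
  imports Defs
begin

text \<open>
  Given \<open>x \<in> dom f\<close> and a feasible \<open>(J, \<xi>)\<close>, the difference between primal and dual objective is
  the sum of \<open>f x - (\<Sum>j\<in>J. f\<^sub>j x)\<close> and of the Fenchel--Young gaps
  \<open>f\<^sub>j\<^sup>* \<xi>\<^sub>j + f\<^sub>j x - \<xi>\<^sub>j x\<close>, all of which are nonnegative. By weak duality (i) says that this
  difference is zero, i.e. that \<open>J \<in> S x\<close> and that all gaps vanish; the memberships in (ii)
  and (iii) each express the vanishing of one gap. The condition in (iv) says that the gap of
  \<open>f\<^sub>j\<^sup>*\<^sup>*\<close> at \<open>x\<close> vanishes, and \<open>f\<^sub>j\<^sup>*\<^sup>* x = f\<^sub>j x\<close> for \<open>f\<^sub>j\<close> in \<open>\<Gamma>\<close> by the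
  Hahn--Banach theorem, which is obtained here from minimal sublinear functionals.
\<close>

subsection \<open>The Hahn--Banach theorem\<close>

definition sublinear :: "('a::real_vector \<Rightarrow> real) \<Rightarrow> bool" where
  "sublinear p \<longleftrightarrow> (\<forall>x y. p (x + y) \<le> p x + p y) \<and> (\<forall>x. \<forall>t>0. p (t *\<^sub>R x) = t * p x)"

text \<open>One inequality suffices for homogeneity: applied to \<open>inverse t\<close> and
  \<open>t *\<^sub>R x\<close> it yields the reverse one.\<close>

lemma sublinearI:
  assumes "\<And>x y. p (x + y) \<le> p x + p y" and "\<And>x t. t > 0 \<Longrightarrow> p (t *\<^sub>R x) \<le> t * p x"
  shows "sublinear p"
proof -
  have "t * p x \<le> p (t *\<^sub>R x)" if "t > 0" for t x
    using assms(2)[of "inverse t" "t *\<^sub>R x"] that by (simp add: field_simps)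
  then show ?thesis
    using assms unfolding sublinear_def by (meson order_antisym)
qed

lemma sublinear_add: "sublinear p \<Longrightarrow> p (x + y) \<le> p x + p y"
  and sublinear_scale: "sublinear p \<Longrightarrow> t > 0 \<Longrightarrow> p (t *\<^sub>R x) = t * p x"
  by (auto simp: sublinear_def)

lemma sublinear_zero: "sublinear p \<Longrightarrow> p 0 = 0"
  using sublinear_scale[of p 2 0] by simp

lemma sublinear_minus_le: "sublinear p \<Longrightarrow> - p (- x) \<le> p x"
  using sublinear_add[of p x "- x"] sublinear_zero[of p] by simp

lemma sublinear_scale_nonneg: "sublinear p \<Longrightarrow> t \<ge> 0 \<Longrightarrow> p (t *\<^sub>R x) = t * p x"
  by (cases "t = 0") (auto simp: sublinear_zero sublinear_scale)

text \<open>A sublinear \<open>q\<close> dominates \<open>\<lambda>z. INF t\<ge>0. q (z + t a) - t q a\<close>, which is again sublinear; if \<open>q\<close>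
  is minimal the two agree, and \<open>t = 1\<close> makes \<open>q\<close> superadditive.\<close>

lemma minimal_sublinear_imp_linear:
  fixes q :: "'a::real_vector \<Rightarrow> real"
  assumes q: "sublinear q" and min: "\<And>r. sublinear r \<Longrightarrow> (\<And>x. r x \<le> q x) \<Longrightarrow> r = q"
  shows "linear q"
proof -
  have super: "q y + q a \<le> q (y + a)" for a y
  proof -
    define r where "r z = (INF t\<in>{0..}. q (z + t *\<^sub>R a) - t * q a)" for z
    \<comment> \<open>Subadditivity at \<open>z + t *\<^sub>R a\<close> and \<open>- z\<close> gives
      a lower bound independent of \<open>t\<close>, so the infimum defining \<open>r z\<close> is a
      true one.\<close>
    have low: "- q (- z) \<le> q (z + t *\<^sub>R a) - t * q a" if "t \<ge> 0" for z t
      using sublinear_add[OF q, of "z + t *\<^sub>R a" "- z"] sublinear_scale_nonneg[OF q that, of a]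
      by simp
    have bdd: "bdd_below ((\<lambda>t. q (z + t *\<^sub>R a) - t * q a) ` {0..})" for z
      using low by (intro bdd_belowI2) auto
    have le: "r z \<le> q (z + t *\<^sub>R a) - t * q a" if "t \<ge> 0" for z t
      unfolding r_def using that by (intro cINF_lower bdd) auto
    have "sublinear r"
    proof (rule sublinearI)
      fix x y
      \<comment> \<open>The parameter \<open>t + u\<close> for \<open>x + y\<close> is split between
        \<open>x\<close> and \<open>y\<close>; the infima over \<open>t\<close> and \<open>u\<close>
        are then taken one after the other.\<close>
      have "r (x + y) - (q (y + u *\<^sub>R a) - u * q a) \<le> q (x + t *\<^sub>R a) - t * q a"
        if "t \<ge> 0" "u \<ge> 0" for t u
        using le[of "t + u" "x + y"] that
          sublinear_add[OF q, of "x + t *\<^sub>R a" "y + u *\<^sub>R a"]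
        by (simp add: algebra_simps)
      then have "r (x + y) - (q (y + u *\<^sub>R a) - u * q a) \<le> r x" if "u \<ge> 0" for u
        unfolding r_def[of x] using that by (intro cINF_greatest) auto
      then have "r (x + y) - r x \<le> q (y + u *\<^sub>R a) - u * q a" if "u \<ge> 0" for u
        using that by (smt (verit))
      then have "r (x + y) - r x \<le> r y"
        unfolding r_def[of y] by (intro cINF_greatest) auto
      then show "r (x + y) \<le> r x + r y" by simp
    next
      fix x and s :: real
      assume s: "s > 0"
      have "r (s *\<^sub>R x) / s \<le> q (x + t *\<^sub>R a) - t * q a" if "t \<ge> 0" for t
      proof -
        have "r (s *\<^sub>R x) \<le> s * (q (x + t *\<^sub>R a) - t * q a)"
          using le[of "s * t" "s *\<^sub>R x"] s that sublinear_scale[OF q s, of "x + t *\<^sub>R a"]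
          by (simp add: algebra_simps)
        then show ?thesis using s by (simp add: field_simps)
      qed
      then have "r (s *\<^sub>R x) / s \<le> r x"
        unfolding r_def[of x] by (intro cINF_greatest) auto
      then show "r (s *\<^sub>R x) \<le> s * r x" using s by (simp add: field_simps)
    qed
    moreover have "r z \<le> q z" for z using le[of 0 z] by simp
    ultimately have "r = q" by (rule min)
    then show ?thesis using le[of 1 y] by simp
  qed
  have add: "q (x + y) = q x + q y" for x y
    using super[of x y] sublinear_add[OF q, of x y] by simp
  have neg: "q (- x) = - q x" for x
    using add[of x "- x"] sublinear_zero[OF q] by simp
  show ?thesis
  proof (rule linearI)
    show "q (t *\<^sub>R x) = t *\<^sub>R q x" for t x
    proof (cases "t \<ge> 0")
      case False
      then show ?thesis
        using sublinear_scale[OF q, of "- t" x] neg[of "t *\<^sub>R x"] by simp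
    qed (simp add: sublinear_scale_nonneg[OF q])
  qed (rule add)
qed

text \<open>In a chain the smaller \<open>m\<close> of \<open>q\<close> and \<open>r\<close>
  satisfies \<open>m (x + y)\<close> \<le> \<open>m x + m y\<close> \<le> \<open>q x + r y\<close>,
  which makes the infimum subadditive. This supplies the lower bounds for Zorn's lemma.\<close>

lemma sublinear_INF_chain:
  fixes C :: "('a::real_vector \<Rightarrow> real) set"
  assumes "C \<noteq> {}" and sub: "\<And>q. q \<in> C \<Longrightarrow> sublinear q"
    and chain: "\<And>q r. q \<in> C \<Longrightarrow> r \<in> C \<Longrightarrow> q \<le> r \<or> r \<le> q"
    and bdd: "\<And>x. bdd_below ((\<lambda>q. q x) ` C)"
  shows "sublinear (\<lambda>x. INF q\<in>C. q x)"
proof -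
  have low: "(INF q\<in>C. q x) \<le> q x" if "q \<in> C" for q x
    using that by (intro cINF_lower bdd)
  show ?thesis
  proof (rule sublinearI)
    fix x y
    have "(INF q\<in>C. q (x + y)) - r y \<le> q x" if q: "q \<in> C" and r: "r \<in> C" for q r
    proof -
      obtain m where "m \<in> C" "m \<le> q" "m \<le> r" using chain[OF q r] q r by blast
      then show ?thesis
        using low[of m "x + y"] sublinear_add[OF sub, of m x y] le_funD[of m q x] le_funD[of m r y]
        by simp
    qed
    then have "(INF q\<in>C. q (x + y)) - r y \<le> (INF q\<in>C. q x)" if "r \<in> C" for r
      using that \<open>C \<noteq> {}\<close> by (intro cINF_greatest) auto
    then have "(INF q\<in>C. q (x + y)) - (INF q\<in>C. q x) \<le> r y" if "r \<in> C" for r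
      using that by (smt (verit))
    then have "(INF q\<in>C. q (x + y)) - (INF q\<in>C. q x) \<le> (INF q\<in>C. q y)"
      using \<open>C \<noteq> {}\<close> by (intro cINF_greatest) auto
    then show "(INF q\<in>C. q (x + y)) \<le> (INF q\<in>C. q x) + (INF q\<in>C. q y)" by simp
  next
    fix x and s :: real
    assume s: "s > 0"
    have "(INF q\<in>C. q (s *\<^sub>R x)) / s \<le> q x" if "q \<in> C" for q
      using low[OF that, of "s *\<^sub>R x"] sublinear_scale[OF sub[OF that] s, of x] s
      by (simp add: field_simps)
    then have "(INF q\<in>C. q (s *\<^sub>R x)) / s \<le> (INF q\<in>C. q x)"
      using \<open>C \<noteq> {}\<close> by (intro cINF_greatest) auto
    then show "(INF q\<in>C. q (s *\<^sub>R x)) \<le> s * (INF q\<in>C. q x)"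
      using s by (simp add: field_simps)
  qed
qed

text \<open>Zorn's lemma for the reversed order gives a minimal sublinear functional below
  \<open>p\<close>, and minimality forces linearity.\<close>

lemma hahn_banach_sublinear:
  fixes p :: "'a::real_vector \<Rightarrow> real"
  assumes p: "sublinear p"
  shows "\<exists>\<phi>. linear \<phi> \<and> (\<forall>x. \<phi> x \<le> p x)"
proof -
  define A where "A = {q. sublinear q \<and> q \<le> p}"
  have "\<exists>m\<in>A. \<forall>a\<in>A. a \<le> m \<longrightarrow> a = m"
  proof (rule predicate_Zorn)
    show "partial_order_on A (relation_of (\<lambda>q r. r \<le> q) A)"
      by (rule partial_order_on_relation_ofI) auto
  next
    fix C assume C: "C \<in> Chains (relation_of (\<lambda>q r. r \<le> q) A)"
    then have CA: "C \<subseteq> A" and chain: "\<And>q r. q \<in> C \<Longrightarrow> r \<in> C \<Longrightarrow> q \<le> r \<or> r \<le> q"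
      by (auto simp: Chains_def relation_of_def)
    show "\<exists>u\<in>A. \<forall>a\<in>C. u \<le> a"
    proof (cases "C = {}")
      case True
      then show ?thesis using p by (auto simp: A_def)
    next
      case False
      \<comment> \<open>From \<open>q\<close> \<le> \<open>p\<close> one gets
        \<open>- p (- x)\<close> \<le> \<open>- q (- x)\<close> \<le> \<open>q x\<close>, a bound
        common to the whole chain.\<close>
      have "- p (- x) \<le> q x" if "q \<in> C" for q x
        using sublinear_minus_le[of q x] that CA le_funD[of q p "- x"] by (force simp: A_def)
      then have bdd: "bdd_below ((\<lambda>q. q x) ` C)" for x
        by (intro bdd_belowI2) auto
      define u where "u x = (INF q\<in>C. q x)" for x
      have le: "u \<le> q" if "q \<in> C" for q
        unfolding u_def using that by (intro le_funI cINF_lower bdd)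
      have "sublinear u"
        unfolding u_def using False CA chain bdd
        by (intro sublinear_INF_chain) (auto simp: A_def)
      moreover have "u \<le> p"
      proof -
        obtain q where "q \<in> C" using False by blast
        then show ?thesis using CA le[of q] by (auto simp: A_def)
      qed
      ultimately show ?thesis using le by (auto simp: A_def)
    qed
  qed
  then obtain m where m: "m \<in> A" and min: "\<And>a. a \<in> A \<Longrightarrow> a \<le> m \<Longrightarrow> a = m" by blast
  have "linear m"
    using m min by (intro minimal_sublinear_imp_linear) (auto simp: A_def le_fun_def intro: order_trans)
  with m show ?thesis by (auto simp: A_def le_fun_def)
qed

text \<open>Let \<open>p y\<close> be the infimum of the slice over \<open>y\<close> of the cone
  generated by \<open>E\<close>. Slices are nonempty by \<open>total\<close> and bounded below by
  \<open>zero\<close>, and convexity makes \<open>p\<close> subadditive, so Hahn--Banach applies to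
  \<open>p\<close>.\<close>

lemma linear_minorant_of_convex_set:
  fixes E :: "('a::real_vector \<times> real) set"
  assumes "convex E" and zero: "\<And>r. (0, r) \<in> E \<Longrightarrow> r \<ge> 0" and total: "\<And>y. \<exists>r. (y, r) \<in> E"
  shows "\<exists>\<phi>. linear \<phi> \<and> (\<forall>(y, r)\<in>E. \<phi> y \<le> r)"
proof -
  define S where "S y = {t * r |t r. t > 0 \<and> (inverse t *\<^sub>R y, r) \<in> E}" for y
  have S_I: "t * r \<in> S (t *\<^sub>R y)" if "(y, r) \<in> E" "t > 0" for y t r
    using that unfolding S_def by force
  have ne: "S y \<noteq> {}" for y
    using total[of y] S_I[of y _ 1] by auto
  have add: "a + b \<in> S (x + y)" if "a \<in> S x" "b \<in> S y" for a b x y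
  proof -
    obtain t r u w where a: "a = t * r" "t > 0" "(inverse t *\<^sub>R x, r) \<in> E"
      and b: "b = u * w" "u > 0" "(inverse u *\<^sub>R y, w) \<in> E"
      using \<open>a \<in> S x\<close> \<open>b \<in> S y\<close> by (auto simp: S_def)
    \<comment> \<open>These weights turn the two points into \<open>(x + y, a + b)\<close> divided
      by \<open>t + u\<close>.\<close>
    have "(t / (t + u)) *\<^sub>R (inverse t *\<^sub>R x, r) + (u / (t + u)) *\<^sub>R (inverse u *\<^sub>R y, w) \<in> E"
      using a b by (intro convexD[OF \<open>convex E\<close>]) (auto simp flip: add_divide_distrib)
    also have "(t / (t + u)) *\<^sub>R (inverse t *\<^sub>R x, r) + (u / (t + u)) *\<^sub>R (inverse u *\<^sub>R y, w) =
        (inverse (t + u) *\<^sub>R (x + y), (a + b) / (t + u))"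
      using a(1,2) b(1,2) by (simp add: scaleR_right_distrib add_divide_distrib) (simp add: divide_inverse)
    finally show ?thesis
      using S_I[of "inverse (t + u) *\<^sub>R (x + y)" "(a + b) / (t + u)" "t + u"] a b by simp
  qed
  have scale: "t * a \<in> S (t *\<^sub>R x)" if "a \<in> S x" "t > 0" for a t x
  proof -
    obtain u r where "a = u * r" "u > 0" "(inverse u *\<^sub>R x, r) \<in> E"
      using \<open>a \<in> S x\<close> by (auto simp: S_def)
    then show ?thesis using S_I[of "inverse u *\<^sub>R x" r "t * u"] that by (simp add: mult.assoc)
  qed
  have nonneg: "a \<ge> 0" if "a \<in> S 0" for a
    using that zero by (auto simp: S_def)
  have bdd: "bdd_below (S y)" for y
  proof -
    \<comment> \<open>Adding a fixed element of the slice over \<open>- y\<close> moves the slice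
      over \<open>y\<close> into the nonnegative slice over \<open>0\<close>.\<close>
    obtain b where "b \<in> S (- y)" using ne by blast
    then have "- b \<le> a" if "a \<in> S y" for a
      using nonneg[of "a + b"] add[OF that, of b "- y"] by simp
    then show ?thesis by (intro bdd_belowI) auto
  qed
  define p where "p y = Inf (S y)" for y
  have low: "p y \<le> a" if "a \<in> S y" for y a
    unfolding p_def by (intro cInf_lower that bdd)
  have "sublinear p"
  proof (rule sublinearI)
    fix x y
    have "p (x + y) - b \<le> p x" if "b \<in> S y" for b
      unfolding p_def[of x] using low[OF add, of _ x b y] that by (intro cInf_greatest ne) force
    then have "p (x + y) - p x \<le> b" if "b \<in> S y" for b
      using that by (smt (verit))
    then have "p (x + y) - p x \<le> p y"
      unfolding p_def[of y] by (intro cInf_greatest ne)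
    then show "p (x + y) \<le> p x + p y" by simp
  next
    fix x and t :: real
    assume t: "t > 0"
    have "p (t *\<^sub>R x) / t \<le> a" if "a \<in> S x" for a
      using low[OF scale[OF that t]] t by (simp add: field_simps)
    then have "p (t *\<^sub>R x) / t \<le> p x"
      unfolding p_def[of x] by (intro cInf_greatest ne)
    then show "p (t *\<^sub>R x) \<le> t * p x" using t by (simp add: field_simps)
  qed
  then obtain \<phi> where \<phi>: "linear \<phi>" "\<And>x. \<phi> x \<le> p x"
    using hahn_banach_sublinear by blast
  have "\<phi> y \<le> r" if "(y, r) \<in> E" for y r
    using \<phi>(2)[of y] low[OF S_I[OF that, of 1]] by simp
  with \<phi>(1) show ?thesis by blast
qed

subsection \<open>Affine minorants in locally convex spaces\<close>

lemma tendsto_scaleR_lcs: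
  fixes x :: "'a::locally_convex_space"
  assumes "(f \<longlongrightarrow> r) F" "(g \<longlongrightarrow> x) F"
  shows "((\<lambda>z. f z *\<^sub>R g z) \<longlongrightarrow> r *\<^sub>R x) F"
  using filterlim_compose[OF tendsto_scaleR_Pair filterlim_Pair[OF assms]] by simp

text \<open>A one-sided bound is enough: applied to a multiple of \<open>y - x\<close> and to its
  negative, it bounds the increment of \<open>\<phi>\<close> from both sides.\<close>

lemma continuous_linear_functionalI:
  fixes \<phi> :: "'a::locally_convex_space \<Rightarrow> real"
  assumes "linear \<phi>" "open V" "0 \<in> V" and bound: "\<And>v. v \<in> V \<Longrightarrow> \<phi> v \<le> M"
  shows "continuous_on UNIV \<phi>"
proof -
  interpret linear \<phi> by fact
  have "(\<phi> \<longlongrightarrow> \<phi> x) (nhds x)" for x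
  proof (rule tendstoI)
    fix e :: real assume "e > 0"
    \<comment> \<open>The summand 1 makes \<open>B\<close> positive and strictly larger than
      \<open>M\<close>, so that scaling by \<open>B / e\<close> ends in a strict inequality.\<close>
    define B where "B = \<bar>M\<bar> + 1"
    have "((\<lambda>y. (B / e) *\<^sub>R (y - x)) \<longlongrightarrow> (B / e) *\<^sub>R (x - x)) (nhds x)"
      by (intro tendsto_scaleR_lcs tendsto_intros filterlim_ident)
    then have "\<forall>\<^sub>F y in nhds x. (B / e) *\<^sub>R (y - x) \<in> V"
      using \<open>open V\<close> \<open>0 \<in> V\<close> by (auto dest: topological_tendstoD)
    moreover have "((\<lambda>y. - (B / e) *\<^sub>R (y - x)) \<longlongrightarrow> - (B / e) *\<^sub>R (x - x)) (nhds x)"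
      by (intro tendsto_scaleR_lcs tendsto_intros filterlim_ident)
    then have "\<forall>\<^sub>F y in nhds x. - (B / e) *\<^sub>R (y - x) \<in> V"
      using \<open>open V\<close> \<open>0 \<in> V\<close> by (auto dest: topological_tendstoD)
    ultimately show "\<forall>\<^sub>F y in nhds x. dist (\<phi> y) (\<phi> x) < e"
    proof eventually_elim
      case (elim y)
      have "B / e * (\<phi> y - \<phi> x) \<le> M" "- (B / e * (\<phi> y - \<phi> x)) \<le> M"
        using bound[OF elim(1)] bound[OF elim(2)] by (simp_all add: scale diff neg)
      then have "\<bar>B / e * (\<phi> y - \<phi> x)\<bar> < B" unfolding B_def by linarith
      moreover have "B > 0" by (simp add: B_def)
      ultimately have "B / e * dist (\<phi> y) (\<phi> x) < B / e * e"
        using \<open>e > 0\<close> by (simp add: abs_mult dist_real_def)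
      then show ?case
        using \<open>e > 0\<close> \<open>B > 0\<close> by (simp only: mult_less_cancel_left_pos divide_pos_pos)
    qed
  qed
  then show ?thesis
    by (simp add: continuous_on_def tendsto_at_within_iff_tendsto_nhds)
qed

text \<open>By continuity of scalar multiplication \<open>y / (n + 1)\<close> tends to
  \<open>0\<close> and so enters \<open>V\<close>.\<close>

lemma absorbing_neighbourhood:
  fixes y :: "'a::locally_convex_space"
  assumes "open V" "0 \<in> V"
  shows "\<exists>s>0. \<exists>v\<in>V. y = s *\<^sub>R v"
proof -
  have "((\<lambda>n. inverse (real (Suc n)) *\<^sub>R y) \<longlongrightarrow> 0 *\<^sub>R y) sequentially"
    by (intro tendsto_scaleR_lcs LIMSEQ_inverse_real_of_nat tendsto_const)
  then have "\<forall>\<^sub>F n in sequentially. inverse (real (Suc n)) *\<^sub>R y \<in> V"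
    using assms by (auto dest: topological_tendstoD)
  then obtain n where "inverse (real (Suc n)) *\<^sub>R y \<in> V"
    using eventually_sequentially by auto
  then show ?thesis
    by (intro exI[of _ "real (Suc n)"] conjI bexI[of _ "inverse (real (Suc n)) *\<^sub>R y"]) auto
qed

lemma convex_scaled_graph:
  fixes V :: "'a::real_vector set"
  assumes "convex V"
  shows "convex {(s *\<^sub>R v, s * d) |s v. s \<ge> 0 \<and> v \<in> V}"
proof (rule convexI, clarsimp)
  fix s1 s2 u1 u2 :: real and v1 v2
  assume *: "0 \<le> u1" "0 \<le> u2" "u1 + u2 = 1" "0 \<le> s1" "0 \<le> s2" "v1 \<in> V" "v2 \<in> V"
  let ?s = "u1 * s1 + u2 * s2"
  show "\<exists>s v. (u1 * s1) *\<^sub>R v1 + (u2 * s2) *\<^sub>R v2 = s *\<^sub>R v \<and>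
      u1 * (s1 * d) + u2 * (s2 * d) = s * d \<and> 0 \<le> s \<and> v \<in> V"
  \<comment> \<open>If the total scale vanishes, so do both terms, and scale \<open>0\<close>
    serves; otherwise dividing by it gives convex weights for \<open>v1\<close> and
    \<open>v2\<close>.\<close>
  proof (cases "?s = 0")
    case True
    then have "u1 * s1 = 0 \<and> u2 * s2 = 0"
      using * by (simp add: add_nonneg_eq_0_iff)
    then show ?thesis using * by (intro exI[of _ 0] exI[of _ v1]) auto
  next
    case False
    have pos: "?s > 0" using False * by (simp add: less_le)
    have "(u1 * s1 / ?s) *\<^sub>R v1 + (u2 * s2 / ?s) *\<^sub>R v2 \<in> V"
      using * pos by (intro convexD[OF assms]) (auto simp flip: add_divide_distrib)
    moreover have "(u1 * s1) *\<^sub>R v1 + (u2 * s2) *\<^sub>R v2 =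
        ?s *\<^sub>R ((u1 * s1 / ?s) *\<^sub>R v1 + (u2 * s2 / ?s) *\<^sub>R v2)"
      using False by (simp add: scaleR_right_distrib)
    ultimately show ?thesis using pos
      by (metis (no_types, lifting) distrib_right less_imp_le mult.assoc)
  qed
qed

lemma convex_funD:
  assumes "convex_fun h" "h y \<le> ereal a" "h z \<le> ereal b" "u \<ge> 0" "v \<ge> 0" "u + v = 1"
  shows "h (u *\<^sub>R y + v *\<^sub>R z) \<le> ereal (u * a + v * b)"
  using convexD[OF assms(1)[unfolded convex_fun_def], of "(y, a)" "(z, b)" u v] assms(2-) by simp

text \<open>
  Below, \<open>E1\<close> is the epigraph of \<open>h - c\<close> moved to the origin and \<open>E2\<close> is the cone generated by
  \<open>V \<times> {d}\<close>, which plays the role of \<open>d\<close> times the gauge of \<open>V\<close>. A linear functional below \<open>E1 + E2\<close>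
  lies below \<open>E1\<close> and is bounded above on \<open>V\<close>, hence continuous.
\<close>

lemma Gamma_fun_affine_minorant:
  fixes h :: "'a::locally_convex_space \<Rightarrow> ereal"
  assumes h: "h \<in> Gamma_fun" and hx: "h x = ereal b" and "c < b"
  shows "\<exists>\<phi>\<in>top_dual. \<forall>y. ereal (c + \<phi> (y - x)) \<le> h y"
proof -
  have cvx: "convex_fun h" and "lsc_fun h" using h by (auto simp: Gamma_fun_def)
  define d where "d = b - c"
  have "d > 0" using \<open>c < b\<close> by (simp add: d_def)
  have "\<forall>\<^sub>F y in nhds x. ereal c < h y"
    using \<open>lsc_fun h\<close> hx \<open>c < b\<close> by (simp add: lsc_fun_def)
  then obtain U where U: "open U" "x \<in> U" "\<And>y. y \<in> U \<Longrightarrow> ereal c < h y"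
    by (auto simp: eventually_nhds)
  have shift: "continuous_on UNIV (\<lambda>y. x - y)"
    by (intro continuous_intros)
  \<comment> \<open>The reflection \<open>x - y\<close> appears because a point of \<open>E\<close>
    over \<open>0\<close> comes from \<open>z = - (s *\<^sub>R v)\<close>, where \<open>h\<close> is
    evaluated at \<open>x - s *\<^sub>R v\<close>.\<close>
  obtain V where V: "open V" "convex V" "0 \<in> V" and VU: "V \<subseteq> (\<lambda>y. x - y) -` U"
    using locally_convex_zero[of "(\<lambda>y. x - y) -` U"] U(1,2) open_vimage[OF U(1) shift] by auto
  define E1 where "E1 = {(z, w). h (x + z) \<le> ereal (c + w)}"
  define E2 where "E2 = {(s *\<^sub>R v, s * d) |s v. s \<ge> 0 \<and> v \<in> V}"
  define E where "E = (\<Union>p\<in>E1. \<Union>q\<in>E2. {p + q})"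
  have "convex E1"
  proof (rule convexI, clarsimp simp: E1_def)
    fix z1 w1 z2 w2 and u v :: real
    assume *: "h (x + z1) \<le> ereal (c + w1)" "h (x + z2) \<le> ereal (c + w2)" "0 \<le> u" "0 \<le> v" "u + v = 1"
    have "u *\<^sub>R (x + z1) + v *\<^sub>R (x + z2) = (u + v) *\<^sub>R x + (u *\<^sub>R z1 + v *\<^sub>R z2)"
      "u * (c + w1) + v * (c + w2) = (u + v) * c + (u * w1 + v * w2)"
      by (simp_all add: algebra_simps)
    then show "h (x + (u *\<^sub>R z1 + v *\<^sub>R z2)) \<le> ereal (c + (u * w1 + v * w2))"
      using convex_funD[OF cvx *] *(5) by simp
  qed
  then have "convex E"
    unfolding E_def E2_def by (intro convex_sums convex_scaled_graph V)
  moreover have "r \<ge> 0" if "(0, r) \<in> E" for r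
  proof -
    from that obtain z w s v where zw: "h (x + z) \<le> ereal (c + w)" "s \<ge> 0" "v \<in> V"
      "z = - (s *\<^sub>R v)" and r: "r = w + s * d"
      by (auto simp: E_def E1_def E2_def add_eq_0_iff2)
    have lower: "ereal c < h (x - u)" if "u \<in> V" for u
      using U(3) VU that by auto
    show "r \<ge> 0"
    \<comment> \<open>For \<open>s\<close> \<le> 1 the point \<open>x - s *\<^sub>R v\<close> is
      still in \<open>U\<close>, where \<open>h\<close> exceeds \<open>c\<close>, so
      \<open>w > 0\<close>. For larger \<open>s\<close> it may leave \<open>U\<close>, and convexity
      along the segment from \<open>x\<close> through \<open>x - v\<close> bounds \<open>w\<close>
      below by \<open>- (s - 1) * d\<close>.\<close>
    proof (cases "s \<le> 1")
      case True
      have "s *\<^sub>R v \<in> V"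
        using convexD[OF V(2) \<open>v \<in> V\<close> V(3), of s "1 - s"] True \<open>s \<ge> 0\<close> by simp
      then have "ereal c < ereal (c + w)"
        using less_le_trans[OF lower[of "s *\<^sub>R v"], of "ereal (c + w)"] zw(1,4) by simp
      then show ?thesis using r \<open>d > 0\<close> \<open>s \<ge> 0\<close> by simp
    next
      case False
      then have s: "s > 1" by simp
      have "(1 - inverse s) *\<^sub>R x + inverse s *\<^sub>R (x + z) = x - v"
        using s zw(4) by (simp add: algebra_simps)
      moreover have "h ((1 - inverse s) *\<^sub>R x + inverse s *\<^sub>R (x + z)) \<le>
          ereal ((1 - inverse s) * b + inverse s * (c + w))"
        using s zw(1) hx by (intro convex_funD[OF cvx]) (auto simp: field_simps)
      ultimately have "ereal c < ereal ((1 - inverse s) * b + inverse s * (c + w))"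
        using lower[OF zw(3)] by (metis less_le_trans)
      then have "c * s < ((1 - inverse s) * b + inverse s * (c + w)) * s"
        using s by simp
      also have "\<dots> = (s - 1) * b + c + w" using s by (simp add: field_simps)
      finally have "0 < (s - 1) * d + w" by (simp add: d_def algebra_simps)
      then show ?thesis using r \<open>d > 0\<close> by (simp add: algebra_simps)
    qed
  qed
  \<comment> \<open>Since \<open>h x = c + d\<close>, the point \<open>(0, d)\<close> is in
    \<open>E1\<close>. The points obtained cover every \<open>y\<close> because \<open>V\<close> is
    absorbing, and \<open>s = 1\<close> bounds \<open>\<phi>\<close> on \<open>V\<close> by
    \<open>2 * d\<close>.\<close>
  moreover have in_E: "(s *\<^sub>R v, d + s * d) \<in> E" if "v \<in> V" "s \<ge> 0" for s v
  proof -
    have "(0, d) \<in> E1" using hx by (simp add: E1_def d_def)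
    moreover have "(s *\<^sub>R v, s * d) \<in> E2" using that by (auto simp: E2_def)
    ultimately show ?thesis unfolding E_def by force
  qed
  moreover have "\<exists>r. (y, r) \<in> E" for y
  proof -
    obtain s v where "s > 0" "v \<in> V" "y = s *\<^sub>R v"
      using absorbing_neighbourhood[OF V(1,3), of y] by blast
    then show ?thesis using in_E[of v s] by auto
  qed
  ultimately obtain \<phi> where \<phi>: "linear \<phi>" "\<And>y r. (y, r) \<in> E \<Longrightarrow> \<phi> y \<le> r"
    using linear_minorant_of_convex_set[of E] by blast
  have "\<phi> v \<le> 2 * d" if "v \<in> V" for v
    using \<phi>(2)[OF in_E[OF that, of 1]] by simp
  then have "continuous_on UNIV \<phi>"
    by (rule continuous_linear_functionalI[OF \<phi>(1) V(1,3)])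
  moreover have "ereal (c + \<phi> (y - x)) \<le> h y" for y
  \<comment> \<open>Testing against real upper bounds \<open>w\<close> of \<open>h y\<close> makes
    the case of an infinite value vacuous.\<close>
  proof (rule ereal_le_real)
    fix w assume w: "h y \<le> ereal w"
    have "(y - x, w - c) \<in> E1" using w by (simp add: E1_def)
    moreover have "(0, 0) \<in> E2" using V(3) by (force simp: E2_def)
    ultimately have "(y - x, w - c) \<in> E" unfolding E_def by force
    from \<phi>(2)[OF this] show "ereal (c + \<phi> (y - x)) \<le> ereal w" by simp
  qed
  ultimately show ?thesis using \<phi>(1) by (auto simp: top_dual_def)
qed

subsection \<open>Conjugates and subdifferentials\<close>

lemma le_fconj: "ereal (\<phi> y) - h y \<le> fconj h \<phi>"
  unfolding fconj_def by (rule SUP_upper) simp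

lemma fconj_not_MInfty:
  assumes "proper_fun h"
  shows "fconj h \<phi> \<noteq> - \<infinity>"
proof -
  obtain y where "h y < \<infinity>" using assms by (auto simp: proper_fun_def edom_def)
  moreover have "h y \<noteq> - \<infinity>" using assms by (simp add: proper_fun_def)
  ultimately show ?thesis using le_fconj[of \<phi> y h] by (cases "h y") auto
qed

text \<open>Rearranged, the subgradient inequality at \<open>y\<close> bounds the
  \<open>y\<close>-term of the supremum \<open>fconj h \<phi>\<close>; the term at \<open>x\<close>
  attains the bound, which gives equality.\<close>

lemma subdiff_iff_fconj:
  assumes "h x = ereal b" "\<phi> \<in> top_dual"
  shows "\<phi> \<in> subdiff h x \<longleftrightarrow> fconj h \<phi> = ereal (\<phi> x - b)"
proof -
  have "\<phi> (y - x) = \<phi> y - \<phi> x" for y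
    using assms(2) by (simp add: top_dual_def linear_diff)
  then have "ereal b + ereal (\<phi> (y - x)) \<le> h y \<longleftrightarrow> ereal (\<phi> y) - h y \<le> ereal (\<phi> x - b)" for y
    by (cases "h y") auto
  then have "\<phi> \<in> subdiff h x \<longleftrightarrow> fconj h \<phi> \<le> ereal (\<phi> x - b)"
    using assms by (simp add: subdiff_def fconj_def SUP_le_iff)
  also have "\<dots> \<longleftrightarrow> fconj h \<phi> = ereal (\<phi> x - b)"
    using le_fconj[of \<phi> x h] assms(1) by auto
  finally show ?thesis .
qed

text \<open>The infimum of \<open>h - \<phi>\<close> is \<open>- fconj h \<phi>\<close>, so
  \<open>x\<close> is a minimizer exactly when the supremum is attained at \<open>x\<close>.\<close>

lemma M_map_iff_fconj:
  assumes "h x = ereal b"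
  shows "x \<in> M_map h \<phi> \<longleftrightarrow> fconj h \<phi> = ereal (\<phi> x - b)"
proof -
  have "h y - ereal (\<phi> y) = - (ereal (\<phi> y) - h y)" for y
    by (cases "h y") auto
  then have "(INF y. h y - ereal (\<phi> y)) = - fconj h \<phi>"
    by (simp add: fconj_def ereal_INF_uminus_eq)
  then show ?thesis
    using assms by (cases "fconj h \<phi>") (auto simp: M_map_def argmin_set_def)
qed

text \<open>Only \<open>h x \<le> h\<^sup>*\<^sup>* x\<close> is needed from the Fenchel--Moreau theorem, and only at points of
  the domain, where the separating hyperplane is never vertical.\<close>

lemma subdiff_dual_iff_fconj:
  fixes h :: "'a::locally_convex_space \<Rightarrow> ereal"
  assumes h: "h \<in> Gamma_fun" and hx: "h x = ereal b"
  shows "x \<in> subdiff_dual (fconj h) \<phi> \<longleftrightarrow> fconj h \<phi> = ereal (\<phi> x - b)"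
proof
  assume "fconj h \<phi> = ereal (\<phi> x - b)"
  then show "x \<in> subdiff_dual (fconj h) \<phi>"
    using le_fconj[of _ x h] hx by (simp add: subdiff_dual_def)
next
  assume *: "x \<in> subdiff_dual (fconj h) \<phi>"
  then obtain k where k: "fconj h \<phi> = ereal k"
    by (cases "fconj h \<phi>") (auto simp: subdiff_dual_def)
  \<comment> \<open>A minorant with slope \<open>\<psi>\<close> and value \<open>c\<close> at
    \<open>x\<close> gives \<open>fconj h \<psi>\<close> \<le> \<open>\<psi> x - c\<close>. Testing
    the dual subgradient inequality at \<open>\<psi>\<close> cancels \<open>\<psi> x\<close>; then
    \<open>c\<close> tends to \<open>b\<close>.\<close>
  have "c \<le> \<phi> x - k" if "c < b" for c
  proof -
    from Gamma_fun_affine_minorant[OF h hx that]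
    obtain \<psi> where \<psi>: "\<psi> \<in> top_dual" "\<And>y. ereal (c + \<psi> (y - x)) \<le> h y" by blast
    have "ereal (\<psi> y) - h y \<le> ereal (\<psi> x - c)" for y
      using \<psi>(2)[of y] \<psi>(1) by (cases "h y") (auto simp: top_dual_def linear_diff)
    then have "fconj h \<psi> \<le> ereal (\<psi> x - c)"
      by (simp add: fconj_def SUP_le_iff)
    moreover have "ereal k + ereal (\<psi> x - \<phi> x) \<le> fconj h \<psi>"
      using * \<psi>(1) k by (auto simp: subdiff_dual_def)
    ultimately have "ereal k + ereal (\<psi> x - \<phi> x) \<le> ereal (\<psi> x - c)" by (rule order_trans[rotated])
    then show ?thesis by simp
  qed
  then have "b \<le> \<phi> x - k" by (rule dense_le)
  then show "fconj h \<phi> = ereal (\<phi> x - b)"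
    using le_fconj[of \<phi> x h] hx k by auto
qed

subsection \<open>Duality for robust sums\<close>

lemma sum_le_robust_sum: "J \<in> fin_subsets I \<Longrightarrow> (\<Sum>j\<in>J. f j x) \<le> robust_sum I f x"
  unfolding robust_sum_def by (rule SUP_upper)

text \<open>Summing the Fenchel--Young inequalities over \<open>J\<close>, the functionals add up to
  \<open>\<phi>\<close> and the values of \<open>f\<close> stay below the robust sum.\<close>

lemma weak_duality:
  fixes f :: "'i \<Rightarrow> 'a::locally_convex_space \<Rightarrow> ereal"
  assumes proper: "\<And>i. i \<in> I \<Longrightarrow> proper_fun (f i)" and p: "p \<in> dual_feasible I \<phi>"
  shows "RD_obj f p \<le> RP_obj I f \<phi> y"
proof -
  obtain J \<xi> where [simp]: "p = (J, \<xi>)" by (cases p)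
  have J: "J \<in> fin_subsets I" "finite J" "J \<subseteq> I" and \<xi>: "(\<Sum>j\<in>J. \<xi> j y) = \<phi> y"
    using p by (auto simp: dual_feasible_def fin_subsets_def)
  show ?thesis
  \<comment> \<open>An infinite value makes the primal objective \<infinity> or the dual one -
    \<infinity>; otherwise the computation takes place in the reals.\<close>
  proof (cases "(\<exists>j\<in>J. f j y = \<infinity>) \<or> (\<exists>j\<in>J. fconj (f j) (\<xi> j) = \<infinity>)")
    case True
    then have "(\<Sum>j\<in>J. f j y) = \<infinity> \<or> (\<Sum>j\<in>J. fconj (f j) (\<xi> j)) = \<infinity>"
      using J(2) by (auto simp: sum_Pinfty)
    then show ?thesis
      using sum_le_robust_sum[OF J(1), of f y] by (auto simp: RP_obj_def RD_obj_def)
  next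
    case False
    define b where "b j = real_of_ereal (f j y)" for j
    define k where "k j = real_of_ereal (fconj (f j) (\<xi> j))" for j
    have b: "f j y = ereal (b j)" and k: "fconj (f j) (\<xi> j) = ereal (k j)" if "j \<in> J" for j
      using False that J(3) proper[of j] fconj_not_MInfty[of "f j" "\<xi> j"]
      by (auto simp: b_def k_def ereal_real proper_fun_def)
    have "\<xi> j y - b j \<le> k j" if "j \<in> J" for j
      using le_fconj[of "\<xi> j" y "f j"] b[OF that] k[OF that] by simp
    then have "\<phi> y - sum b J \<le> sum k J"
      unfolding \<xi>[symmetric] sum_subtractf[symmetric] by (rule sum_mono)
    moreover have "ereal (sum b J) \<le> robust_sum I f y"
      using sum_le_robust_sum[OF J(1), of f y] b by simp
    ultimately show ?thesis
      using k by (cases "robust_sum I f y") (auto simp: RP_obj_def RD_obj_def)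
  qed
qed

text \<open>The dual value at \<open>p\<close>, the dual supremum, the primal infimum and the primal
  value at \<open>x\<close> increase in this order, so equal ends force equality throughout.\<close>

lemma optimal_pair_iff:
  fixes f :: "'i \<Rightarrow> 'a::locally_convex_space \<Rightarrow> ereal"
  assumes proper: "\<And>i. i \<in> I \<Longrightarrow> proper_fun (f i)" and p: "p \<in> dual_feasible I \<phi>"
  shows "x \<in> sol_RP I f \<phi> \<and> p \<in> sol_RD I f \<phi> \<and> inf_RP I f \<phi> = sup_RD I f \<phi>
    \<longleftrightarrow> RD_obj f p = RP_obj I f \<phi> x"
proof
  assume eq: "RD_obj f p = RP_obj I f \<phi> x"
  have "inf_RP I f \<phi> \<le> RP_obj I f \<phi> x"
    unfolding inf_RP_def by (rule INF_lower) simp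
  moreover have "RD_obj f p \<le> sup_RD I f \<phi>"
    unfolding sup_RD_def by (rule SUP_upper) (rule p)
  moreover have "sup_RD I f \<phi> \<le> inf_RP I f \<phi>"
    unfolding sup_RD_def inf_RP_def using weak_duality[OF proper]
    by (intro SUP_least INF_greatest)
  ultimately show "x \<in> sol_RP I f \<phi> \<and> p \<in> sol_RD I f \<phi> \<and> inf_RP I f \<phi> = sup_RD I f \<phi>"
    using eq p by (auto simp: sol_RP_def sol_RD_def)
qed (auto simp: sol_RP_def sol_RD_def)

lemma RD_obj_eq_RP_obj_iff:
  fixes f :: "'i \<Rightarrow> 'a::locally_convex_space \<Rightarrow> ereal"
  assumes proper: "\<And>i. i \<in> I \<Longrightarrow> proper_fun (f i)" and p: "(J, \<xi>) \<in> dual_feasible I \<phi>"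
    and b: "\<And>j. j \<in> J \<Longrightarrow> f j x = ereal (b j)" and F: "robust_sum I f x = ereal F"
  shows "RD_obj f (J, \<xi>) = RP_obj I f \<phi> x \<longleftrightarrow>
    sum b J = F \<and> (\<forall>j\<in>J. fconj (f j) (\<xi> j) = ereal (\<xi> j x - b j))"
proof -
  have J: "J \<in> fin_subsets I" "finite J" "J \<subseteq> I" and \<xi>: "(\<Sum>j\<in>J. \<xi> j x) = \<phi> x"
    using p by (auto simp: dual_feasible_def fin_subsets_def)
  show ?thesis
  proof
    assume "RD_obj f (J, \<xi>) = RP_obj I f \<phi> x"
    then have "- (\<Sum>j\<in>J. fconj (f j) (\<xi> j)) = ereal (F - \<phi> x)"
      using F by (simp add: RD_obj_def RP_obj_def)
    then have sum_eq: "(\<Sum>j\<in>J. fconj (f j) (\<xi> j)) = ereal (\<phi> x - F)"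
      by (cases "\<Sum>j\<in>J. fconj (f j) (\<xi> j)") auto
    define k where "k j = real_of_ereal (fconj (f j) (\<xi> j))" for j
    have k: "fconj (f j) (\<xi> j) = ereal (k j)" if "j \<in> J" for j
    proof -
      have "fconj (f j) (\<xi> j) \<noteq> \<infinity>"
        using sum_eq J(2) that by (metis PInfty_neq_ereal(1) sum_Pinfty)
      then show ?thesis
        using fconj_not_MInfty[of "f j" "\<xi> j"] proper J(3) that by (auto simp: k_def ereal_real)
    qed
    have le: "\<xi> j x - b j \<le> k j" if "j \<in> J" for j
      using le_fconj[of "\<xi> j" x "f j"] b[OF that] k[OF that] by simp
    have "sum k J = \<phi> x - F" using sum_eq k by simp
    \<comment> \<open>The left side is nonnegative and the right side nonpositive, so both vanish,
      and with the sum each gap.\<close>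
    then have gap: "(\<Sum>j\<in>J. k j - (\<xi> j x - b j)) = sum b J - F"
      by (simp add: sum_subtractf \<xi>)
    moreover have "sum b J \<le> F"
      using sum_le_robust_sum[OF J(1), of f x] b F by simp
    moreover have "0 \<le> (\<Sum>j\<in>J. k j - (\<xi> j x - b j))"
      using le by (intro sum_nonneg) simp
    ultimately have "sum b J = F" "(\<Sum>j\<in>J. k j - (\<xi> j x - b j)) = 0" by auto
    then show "sum b J = F \<and> (\<forall>j\<in>J. fconj (f j) (\<xi> j) = ereal (\<xi> j x - b j))"
      using le k J(2) by (simp add: sum_nonneg_eq_0_iff)
  next
    assume "sum b J = F \<and> (\<forall>j\<in>J. fconj (f j) (\<xi> j) = ereal (\<xi> j x - b j))"
    then show "RD_obj f (J, \<xi>) = RP_obj I f \<phi> x"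
      using F by (simp add: RD_obj_def RP_obj_def sum_subtractf \<xi>)
  qed
qed

theorem theorem4p1:
  fixes I :: "'i set"
    and f :: "'i \<Rightarrow> 'a::locally_convex_space \<Rightarrow> ereal"
    and xbar :: "'a \<Rightarrow> real"
    and x :: 'a
    and J :: "'i set"
    and xs :: "'i \<Rightarrow> 'a \<Rightarrow> real"
  assumes "infinite I"
    and "\<And>i. i \<in> I \<Longrightarrow> proper_fun (f i)"
    and "xbar \<in> top_dual"
    and "x \<in> edom (robust_sum I f)"
    and "(J, xs) \<in> dual_feasible I xbar"
  shows
    "((x \<in> sol_RP I f xbar \<and> (J, xs) \<in> sol_RD I f xbar \<and> inf_RP I f xbar = sup_RD I f xbar)
        \<longleftrightarrow> (J \<in> S_map I f x \<and> (\<forall>j\<in>J. xs j \<in> subdiff (f j) x)))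
     \<and> ((J \<in> S_map I f x \<and> (\<forall>j\<in>J. xs j \<in> subdiff (f j) x))
        \<longleftrightarrow> x \<in> T_map I f J \<inter> (\<Inter>j\<in>J. M_map (f j) (xs j)))
     \<and> ((\<forall>i\<in>I. f i \<in> Gamma_fun) \<longrightarrow>
        (x \<in> T_map I f J \<inter> (\<Inter>j\<in>J. M_map (f j) (xs j))
        \<longleftrightarrow> x \<in> T_map I f J \<inter> (\<Inter>j\<in>J. subdiff_dual (fconj (f j)) (xs j))))"
proof -
  have J: "J \<in> fin_subsets I" "J \<subseteq> I" and xs: "\<And>j. j \<in> J \<Longrightarrow> xs j \<in> top_dual"
    using assms(5) by (auto simp: dual_feasible_def fin_subsets_def PiE_def Pi_def)
  define b where "b j = real_of_ereal (f j x)" for j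
  define F where "F = real_of_ereal (robust_sum I f x)"
  have b: "f j x = ereal (b j)" if "j \<in> J" for j
  proof -
    \<comment> \<open>The singleton \<open>{j}\<close> is one of the finite subsets, so finiteness
      of the robust sum passes to each \<open>f j x\<close>.\<close>
    have "f j x \<le> robust_sum I f x"
      using sum_le_robust_sum[of "{j}" I f x] that J(2) by (auto simp: fin_subsets_def)
    then have "f j x \<noteq> \<infinity>" using assms(4) by (auto simp: edom_def)
    moreover have "f j x \<noteq> - \<infinity>"
      using assms(2)[of j] that J(2) by (auto simp: proper_fun_def)
    ultimately show ?thesis by (auto simp: b_def ereal_real)
  qed
  have F: "robust_sum I f x = ereal F"
    using sum_le_robust_sum[OF J(1), of f x] b assms(4)
    by (cases "robust_sum I f x") (auto simp: edom_def F_def)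
  have S: "J \<in> S_map I f x \<longleftrightarrow> sum b J = F"
    using assms(4) J(1) b F by (simp add: S_map_def)
  have "(x \<in> sol_RP I f xbar \<and> (J, xs) \<in> sol_RD I f xbar \<and> inf_RP I f xbar = sup_RD I f xbar)
      \<longleftrightarrow> RD_obj f (J, xs) = RP_obj I f xbar x"
    using assms(2,5) by (rule optimal_pair_iff)
  moreover have "RD_obj f (J, xs) = RP_obj I f xbar x \<longleftrightarrow>
      sum b J = F \<and> (\<forall>j\<in>J. fconj (f j) (xs j) = ereal (xs j x - b j))"
    using assms(2,5) b F by (rule RD_obj_eq_RP_obj_iff)
  moreover have "(\<forall>j\<in>J. xs j \<in> subdiff (f j) x) \<longleftrightarrow>
      (\<forall>j\<in>J. fconj (f j) (xs j) = ereal (xs j x - b j))"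
    by (intro ball_cong refl subdiff_iff_fconj b xs)
  moreover have "x \<in> (\<Inter>j\<in>J. M_map (f j) (xs j)) \<longleftrightarrow>
      (\<forall>j\<in>J. fconj (f j) (xs j) = ereal (xs j x - b j))"
    unfolding INT_iff by (intro ball_cong refl M_map_iff_fconj b)
  moreover have "x \<in> (\<Inter>j\<in>J. subdiff_dual (fconj (f j)) (xs j)) \<longleftrightarrow>
      (\<forall>j\<in>J. fconj (f j) (xs j) = ereal (xs j x - b j))" if "\<forall>i\<in>I. f i \<in> Gamma_fun"
    unfolding INT_iff using that J(2)
    by (intro ball_cong refl subdiff_dual_iff_fconj b) auto
  ultimately show ?thesis
    using S by (auto simp: T_map_def)
qed

end
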